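(* (a) Suppose that $G$ is a noncyclotomic bipartite graph having a vertex $v$ such that the induced subgraph on $V(G)\setminus\{v\}$ is cyclotomic. Then $G$ is a Salem graph. (b) Suppose that $G$ is a noncyclotomic bipartite graph with the property that for each minimal induced subgraph $M$ of $G$, the complementary induced subgraph $G|_{V(G)\setminus V(M)}$ is cyclotomic. Then $G$ is a Salem graph.
   Context: Graphs are finite simple graphs; eigenvalues are those of the adjacency matrix; the index of a graph is its largest eigenvalue. A graph is cyclotomic if all its eigenvalues lie in $[-2,2]$. A minimal induced subgraph of $G$ means an induced subgraph of $G$ with index greater than $2$ such that every induced subgraph of it obtained by deleting one vertex has index at most $2$. A bipartite graph $G$ is a Salem graph if it has exactly one eigenvalue $\lambda>2$ and only the eigenvalue $-\lambda$ in $(-\infty,-2)$. *)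

theory Defs
  imports "Jordan_Normal_Form.Char_Poly"
begin

text \<open>A finite simple graph: finite vertex set V and a symmetric irreflexive
  adjacency relation E supported on V.  The induced subgraph on S \<subseteq> V is
  represented by the pair (S, E): only edges between vertices of S are ever read.\<close>

definition simple_graph :: "'a set \<Rightarrow> ('a \<Rightarrow> 'a \<Rightarrow> bool) \<Rightarrow> bool" where
  "simple_graph V E \<longleftrightarrow> finite V \<and> (\<forall>u w. E u w \<longrightarrow> u \<in> V \<and> w \<in> V)
     \<and> (\<forall>u w. E u w \<longrightarrow> E w u) \<and> (\<forall>u. \<not> E u u)"

definition bipartite :: "'a set \<Rightarrow> ('a \<Rightarrow> 'a \<Rightarrow> bool) \<Rightarrow> bool" where
  "bipartite V E \<longleftrightarrow> (\<exists>A \<subseteq> V. \<forall>u\<in>V. \<forall>w\<in>V. E u w \<longrightarrow> (u \<in> A \<longleftrightarrow> w \<notin> A))"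

definition adj_mat :: "'a::linorder set \<Rightarrow> ('a \<Rightarrow> 'a \<Rightarrow> bool) \<Rightarrow> real mat" where
  "adj_mat S E = (let vs = sorted_list_of_set S in
     mat (card S) (card S) (\<lambda>(i, j). if E (vs ! i) (vs ! j) then 1 else 0))"

definition graph_eigenvalue :: "'a::linorder set \<Rightarrow> ('a \<Rightarrow> 'a \<Rightarrow> bool) \<Rightarrow> real \<Rightarrow> bool" where
  "graph_eigenvalue S E x \<longleftrightarrow> eigenvalue (adj_mat S E) x"

definition eig_mult :: "'a::linorder set \<Rightarrow> ('a \<Rightarrow> 'a \<Rightarrow> bool) \<Rightarrow> real \<Rightarrow> nat" where
  "eig_mult S E x = order x (char_poly (adj_mat S E))"

definition graph_index :: "'a::linorder set \<Rightarrow> ('a \<Rightarrow> 'a \<Rightarrow> bool) \<Rightarrow> real" where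
  "graph_index S E = (if S = {} then 0 else Max {x. graph_eigenvalue S E x})"

definition cyclotomic :: "'a::linorder set \<Rightarrow> ('a \<Rightarrow> 'a \<Rightarrow> bool) \<Rightarrow> bool" where
  "cyclotomic S E \<longleftrightarrow> (\<forall>x. graph_eigenvalue S E x \<longrightarrow> -2 \<le> x \<and> x \<le> 2)"

definition minimal_induced :: "'a::linorder set \<Rightarrow> ('a \<Rightarrow> 'a \<Rightarrow> bool) \<Rightarrow> 'a set \<Rightarrow> bool" where
  "minimal_induced V E M \<longleftrightarrow> M \<subseteq> V \<and> graph_index M E > 2
     \<and> (\<forall>v\<in>M. graph_index (M - {v}) E \<le> 2)"

definition salem_graph :: "'a::linorder set \<Rightarrow> ('a \<Rightarrow> 'a \<Rightarrow> bool) \<Rightarrow> bool" where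
  "salem_graph V E \<longleftrightarrow> bipartite V E \<and>
     (\<exists>l > 2. eig_mult V E l = 1 \<and> (\<forall>x. graph_eigenvalue V E x \<and> x > 2 \<longrightarrow> x = l)
        \<and> eig_mult V E (-l) = 1 \<and> (\<forall>x. graph_eigenvalue V E x \<and> x < -2 \<longrightarrow> x = -l))"

end

theory Submission
  imports Defs "Jordan_Normal_Form.Column_Operations" "HOL-Analysis.Function_Topology"
begin

text \<open>A bipartite graph has a spectrum symmetric about 0, so a noncyclotomic bipartite graph that is not
  Salem has two eigenvalues above 2, counted with multiplicity, and hence two orthogonal eigenvectors
  \<open>f\<close>, \<open>g\<close> with eigenvalues above 2. For (a), a nonzero combination of \<open>f\<close> and \<open>g\<close> vanishes at \<open>v\<close>, and
  its Rayleigh quotient shows that deleting \<open>v\<close> leaves an eigenvalue above 2. For (b), the part of an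
  eigenvector where it is positive already has Rayleigh quotient above 2 on its support, since
  adjacency matrices are nonnegative; using \<open>f\<close>, \<open>g\<close> and their negatives one finds two disjoint
  vertex sets that both induce noncyclotomic graphs, and a minimal induced subgraph inside the
  first has a noncyclotomic complement.\<close>

section \<open>Eigenfunctions and symmetric bilinear forms on a finite vertex set\<close>

text \<open>Functions on the whole vertex type stand in for vectors. Values outside \<open>S\<close>
  are never read, so passing to an induced subgraph needs no reindexing.\<close>

definition eigenfunction :: "'a set \<Rightarrow> ('a \<Rightarrow> 'a \<Rightarrow> real) \<Rightarrow> real \<Rightarrow> ('a \<Rightarrow> real) \<Rightarrow> bool" where
  "eigenfunction S a l f \<longleftrightarrow>
     (\<exists>u\<in>S. f u \<noteq> 0) \<and> (\<forall>u\<in>S. (\<Sum>w\<in>S. a u w * f w) = l * f u)"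

definition bilin :: "'a set \<Rightarrow> ('a \<Rightarrow> 'a \<Rightarrow> real) \<Rightarrow> ('a \<Rightarrow> real) \<Rightarrow> ('a \<Rightarrow> real) \<Rightarrow> real" where
  "bilin S a f g = (\<Sum>u\<in>S. f u * (\<Sum>w\<in>S. a u w * g w))"

lemma bilin_add_right: "bilin S a f (\<lambda>u. g u + h u) = bilin S a f g + bilin S a f h"
  by (simp add: bilin_def algebra_simps sum.distrib)

lemma bilin_add_left: "bilin S a (\<lambda>u. g u + h u) f = bilin S a g f + bilin S a h f"
  by (simp add: bilin_def algebra_simps sum.distrib)

lemma bilin_scale_right: "bilin S a f (\<lambda>u. c * g u) = c * bilin S a f g"
  by (simp add: bilin_def sum_distrib_left mult_ac)

lemma bilin_scale_left: "bilin S a (\<lambda>u. c * g u) f = c * bilin S a g f"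
  by (simp add: bilin_def sum_distrib_left mult_ac)

lemma bilin_commute:
  assumes "\<And>u w. a u w = a w u"
  shows "bilin S a f g = bilin S a g f"
proof -
  have "bilin S a f g = (\<Sum>u\<in>S. \<Sum>w\<in>S. f u * (a u w * g w))"
    by (simp add: bilin_def sum_distrib_left)
  also have "\<dots> = (\<Sum>w\<in>S. \<Sum>u\<in>S. f u * (a u w * g w))" by (rule sum.swap)
  also have "\<dots> = bilin S a g f"
    by (simp add: bilin_def sum_distrib_left mult_ac assms)
  finally show ?thesis .
qed

lemma eigenfunction_bilin:
  assumes "eigenfunction S a l f"
  shows "bilin S a g f = l * (\<Sum>u\<in>S. g u * f u)"
  using assms by (simp add: bilin_def eigenfunction_def sum_distrib_left mult_ac)

lemma sum_sq_pos:
  fixes f :: "'a \<Rightarrow> real"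
  assumes "finite S" "u \<in> S" "f u \<noteq> 0"
  shows "0 < (\<Sum>u\<in>S. f u * f u)"
  by (rule sum_pos2[OF assms(1,2)]) (use assms in \<open>auto simp: zero_less_mult_iff\<close>)

lemma eigenfunction_sq_pos:
  assumes "finite S" "eigenfunction S a l f"
  shows "0 < (\<Sum>u\<in>S. f u * f u)"
proof -
  from assms(2) obtain u where "u \<in> S" "f u \<noteq> 0" by (auto simp: eigenfunction_def)
  with assms(1) show ?thesis by (rule sum_sq_pos)
qed

lemma eigenfunctions_orthogonal:
  assumes "\<And>u w. a u w = a w u" "eigenfunction S a l f" "eigenfunction S a m g" "l \<noteq> m"
  shows "(\<Sum>u\<in>S. f u * g u) = 0"
proof -
  have "m * (\<Sum>u\<in>S. f u * g u) = l * (\<Sum>u\<in>S. g u * f u)"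
    using bilin_commute[of a S f g, OF assms(1)] eigenfunction_bilin[OF assms(2), of g]
      eigenfunction_bilin[OF assms(3), of f] by simp
  with assms(4) show ?thesis by (simp add: mult.commute)
qed

section \<open>The Rayleigh principle\<close>

text \<open>With \<open>r\<close> the entry at \<open>v\<close> of \<open>b\<close> applied to
  \<open>f\<close>, and \<open>e\<close> the indicator of \<open>v\<close>, the form at
  \<open>f + t e\<close> equals \<open>2 t r + t^2 b v v\<close>. If \<open>r\<close> were nonzero,
  a small \<open>t\<close> of the opposite sign would make this negative.\<close>

lemma psd_form_zero_imp_kernel:
  assumes S: "finite S" and sym: "\<And>u w. b u w = b w u"
    and psd: "\<And>g. bilin S b g g \<ge> 0" and z: "bilin S b f f = 0" and v: "v \<in> S"
  shows "(\<Sum>w\<in>S. b v w * f w) = 0"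
proof -
  define r where "r = (\<Sum>w\<in>S. b v w * f w)"
  define e :: "'a \<Rightarrow> real" where "e = (\<lambda>u. if u = v then 1 else 0)"
  \<comment> \<open>This \<open>k\<close> is positive and at least \<open>b v v\<close>, so the
    choice \<open>t = - r / k\<close> bounds the form above by \<open>- r^2 / k\<close>.\<close>
  define k where "k = \<bar>b v v\<bar> + 1"
  have ef: "bilin S b e f = r" and ee: "bilin S b e e = b v v"
    using S v by (simp_all add: bilin_def e_def r_def if_distrib[of "\<lambda>x. x * _"]
        if_distrib[of "\<lambda>x. _ * x"] cong: if_cong)
  have fe: "bilin S b f e = r" using bilin_commute[of b S f e, OF sym] ef by simp
  have k: "k > 0" "b v v \<le> k" "k \<noteq> 0" by (auto simp: k_def)
  have "0 \<le> bilin S b (\<lambda>u. f u + (- r / k) * e u) (\<lambda>u. f u + (- r / k) * e u)"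
    by (rule psd)
  also have "\<dots> = - (2 * r\<^sup>2 / k) + r\<^sup>2 * b v v / k\<^sup>2"
    unfolding bilin_add_right bilin_add_left bilin_scale_right bilin_scale_left
    by (simp add: ef fe ee z power2_eq_square)
  also have "\<dots> \<le> - (2 * r\<^sup>2 / k) + r\<^sup>2 * k / k\<^sup>2"
    using k by (intro add_left_mono divide_right_mono mult_left_mono) auto
  also have "\<dots> = - (r\<^sup>2 / k)" using k by (simp add: power2_eq_square field_simps)
  finally have "r\<^sup>2 / k \<le> 0" by simp
  then have "r\<^sup>2 \<le> 0" using k by (simp add: divide_le_0_iff)
  then show ?thesis by (simp add: r_def)
qed

text \<open>In the product topology the sphere is a closed subset of a box with side
  \<open>[-1, 1]\<close> at vertices of \<open>S\<close> and the single point 0 elsewhere;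
  Tychonoff's theorem makes the box compact. Without the condition outside \<open>S\<close> the set
  could be unbounded in those coordinates.\<close>

lemma compact_unit_sphere_fun:
  fixes S :: "'a set"
  assumes S: "finite S"
  shows "compact {f :: 'a \<Rightarrow> real. (\<forall>u. u \<notin> S \<longrightarrow> f u = 0) \<and> (\<Sum>u\<in>S. f u * f u) = 1}"
    (is "compact ?K")
proof -
  define C where "C = (\<lambda>u. if u \<in> S then {-1..1} else {0 :: real})"
  have "compactin (product_topology (\<lambda>u. euclidean) UNIV) (PiE UNIV C)"
    by (subst compactin_PiE) (auto simp: C_def)
  then have c: "compact (PiE UNIV C)"
    by (simp add: euclidean_product_topology)
  have cl: "closed {f :: 'a \<Rightarrow> real. (\<Sum>u\<in>S. f u * f u) = 1}"
    by (intro closed_Collect_eq continuous_intros continuous_on_product_coordinates)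
  have "?K = PiE UNIV C \<inter> {f. (\<Sum>u\<in>S. f u * f u) = 1}"
  proof (intro equalityI subsetI)
    fix f assume f: "f \<in> ?K"
    have "\<bar>f u\<bar> \<le> 1" if "u \<in> S" for u
    proof -
      have "f u * f u \<le> (\<Sum>u\<in>S. f u * f u)"
        by (rule member_le_sum) (use S that in auto)
      with f have "(f u)\<^sup>2 \<le> 1" by (simp add: power2_eq_square)
      then show ?thesis by (simp only: abs_square_le_1)
    qed
    with f show "f \<in> PiE UNIV C \<inter> {f. (\<Sum>u\<in>S. f u * f u) = 1}"
      by (auto simp: C_def abs_le_iff minus_le_iff)
  next
    fix f assume "f \<in> PiE UNIV C \<inter> {f. (\<Sum>u\<in>S. f u * f u) = 1}"
    then show "f \<in> ?K" by (auto simp: C_def PiE_iff split: if_splits)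
  qed
  with compact_Int_closed[OF c cl] show ?thesis by simp
qed

text \<open>The form attains a maximum \<open>m > c\<close> on the unit sphere. Then
  \<open>m I - a\<close> is positive semidefinite and its form vanishes at the maximiser, which
  therefore lies in its kernel.\<close>

lemma rayleigh_eigenfunction:
  assumes S: "finite S" and sym: "\<And>u w. a u w = a w u"
    and f: "bilin S a f f > c * (\<Sum>u\<in>S. f u * f u)"
  shows "\<exists>l > c. \<exists>g. eigenfunction S a l g"
proof -
  define K where "K = {g :: 'a \<Rightarrow> real. (\<forall>u. u \<notin> S \<longrightarrow> g u = 0) \<and> (\<Sum>u\<in>S. g u * g u) = 1}"
  define nrm where "nrm g = (\<Sum>u\<in>S. g u * g u)" for g :: "'a \<Rightarrow> real"
  have nrm0: "bilin S a g g = 0 \<and> nrm g = 0" if "\<not> nrm g > 0" for g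
  proof -
    have "g u = 0" if "u \<in> S" for u
      using sum_sq_pos[OF S that] \<open>\<not> nrm g > 0\<close> by (auto simp: nrm_def)
    then show ?thesis by (simp add: bilin_def nrm_def)
  qed
  \<comment> \<open>Besides normalising, \<open>unit\<close> resets the values outside
    \<open>S\<close> to 0, as membership in \<open>K\<close> demands.\<close>
  define unit where "unit g = (\<lambda>u. if u \<in> S then (1 / sqrt (nrm g)) * g u else 0)" for g :: "'a \<Rightarrow> real"
  have unitK: "unit g \<in> K" if "nrm g > 0" for g
  proof -
    have "(\<Sum>u\<in>S. unit g u * unit g u) = (\<Sum>u\<in>S. (1 / nrm g) * (g u * g u))"
      using that by (intro sum.cong refl) (simp add: unit_def)
    also have "\<dots> = (1 / nrm g) * nrm g" by (simp only: sum_distrib_left nrm_def)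
    also have "\<dots> = 1" using that by simp
    finally show ?thesis by (simp add: K_def unit_def)
  qed
  have unit_q: "bilin S a (unit g) (unit g) = bilin S a g g / nrm g" if "nrm g > 0" for g
  proof -
    have "bilin S a (unit g) (unit g)
        = bilin S a (\<lambda>u. (1 / sqrt (nrm g)) * g u) (\<lambda>u. (1 / sqrt (nrm g)) * g u)"
      by (simp add: bilin_def unit_def)
    also have "\<dots> = bilin S a g g / nrm g"
      unfolding bilin_scale_left bilin_scale_right using that by simp
    finally show ?thesis .
  qed
  have fpos: "nrm f > 0" using nrm0[of f] f by (cases "nrm f > 0") (simp_all add: nrm_def)
  have "compact K" unfolding K_def by (rule compact_unit_sphere_fun[OF S])
  moreover have "K \<noteq> {}" using unitK[OF fpos] by auto
  moreover have "continuous_on K (\<lambda>g. bilin S a g g)"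
    unfolding bilin_def
    by (intro continuous_intros continuous_on_subset[OF continuous_on_product_coordinates]) auto
  ultimately obtain g where g: "g \<in> K" "\<And>h. h \<in> K \<Longrightarrow> bilin S a h h \<le> bilin S a g g"
    using continuous_attains_sup[of K "\<lambda>g. bilin S a g g"] by blast
  define m where "m = bilin S a g g"
  have bound: "bilin S a h h \<le> m * nrm h" for h
  proof (cases "nrm h > 0")
    case True
    then show ?thesis using g(2)[OF unitK[OF True]] unit_q[OF True]
      by (simp add: m_def field_simps)
  next
    case False
    then show ?thesis using nrm0[OF False] by simp
  qed
  have mc: "m > c"
  proof -
    have "c * nrm f < m * nrm f" using bound[of f] f by (simp add: nrm_def)
    with fpos show ?thesis by simp
  qed
  \<comment> \<open>This is the matrix \<open>m I - a\<close>.\<close>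
  define b where "b = (\<lambda>u w. (if u = w then m else 0) - a u w)"
  have row: "(\<Sum>w\<in>S. b u w * h w) = m * h u - (\<Sum>w\<in>S. a u w * h w)" if "u \<in> S" for u h
    using S that by (simp add: b_def left_diff_distrib sum_subtractf if_distrib[of "\<lambda>x. x * _"] cong: if_cong)
  have form: "bilin S b h h = m * nrm h - bilin S a h h" for h
  proof -
    have "bilin S b h h = (\<Sum>u\<in>S. h u * (m * h u - (\<Sum>w\<in>S. a u w * h w)))"
      unfolding bilin_def by (intro sum.cong refl) (simp add: row)
    also have "\<dots> = m * nrm h - bilin S a h h"
      by (simp add: right_diff_distrib sum_subtractf bilin_def nrm_def sum_distrib_left mult_ac)
    finally show ?thesis .
  qed
  have ng: "nrm g = 1" using g(1) by (simp add: K_def nrm_def)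
  have "(\<Sum>w\<in>S. b u w * g w) = 0" if "u \<in> S" for u
  proof (rule psd_form_zero_imp_kernel[OF S _ _ _ that])
    show "b u w = b w u" for u w using sym[of u w] by (simp add: b_def)
    show "bilin S b h h \<ge> 0" for h using bound[of h] by (simp add: form)
    show "bilin S b g g = 0" by (simp add: form ng m_def)
  qed
  then have "\<forall>u\<in>S. (\<Sum>w\<in>S. a u w * g w) = m * g u" by (simp add: row)
  moreover have "\<exists>u\<in>S. g u \<noteq> 0" using ng by (auto simp: nrm_def intro: ccontr)
  ultimately have "eigenfunction S a m g" by (simp add: eigenfunction_def)
  with mc show ?thesis by blast
qed

section \<open>Multiple roots of the characteristic polynomial of a symmetric matrix\<close>

lemma det_multcol:
  assumes "k < n" "A \<in> carrier_mat n n"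
  shows "det (multcol k a A) = a * det (A :: 'b :: comm_ring_1 mat)"
  using assms det_mult[OF assms(2) multrow_mat_carrier[of n k a]]
  by (simp add: multcol_mat[OF assms(2)] det_multrow_mat)

text \<open>Cramer's rule over polynomials: if \<open>A x = l x\<close> then \<open>x\<^sub>k \<chi>\<^sub>A\<close> is \<open>X - l\<close> times the
  determinant of \<open>X I - A\<close> with its \<open>k\<close>-th column replaced by \<open>x\<close>. If \<open>l\<close> is a multiple root, that
  matrix is singular at \<open>l\<close>, and by symmetry of \<open>A\<close> a kernel vector \<open>y\<close> of it has \<open>y\<^sub>k = 0\<close>, so
  it is an eigenvector of \<open>A\<close>.\<close>

lemma symmetric_multiple_root_eigenvector:
  fixes A :: "real mat"
  assumes A: "A \<in> carrier_mat n n" and sym: "\<And>i j. i < n \<Longrightarrow> j < n \<Longrightarrow> A $$ (i,j) = A $$ (j,i)"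
    and x: "eigenvector A x l" and k: "k < n" "x $ k \<noteq> 0"
    and ord: "order l (char_poly A) \<ge> 2"
  shows "\<exists>y. eigenvector A y l \<and> y $ k = 0"
proof -
  have xc: "x \<in> carrier_vec n" and Ax: "A *\<^sub>v x = l \<cdot>\<^sub>v x"
    using x A by (auto simp: eigenvector_def)
  have Axi: "(\<Sum>j<n. A $$ (i,j) * x $ j) = l * x $ i" if "i < n" for i
  proof -
    have "(A *\<^sub>v x) $ i = (\<Sum>j<n. A $$ (i,j) * x $ j)"
      using A xc that by (simp add: scalar_prod_def lessThan_atLeast0)
    then show ?thesis using Ax xc that by simp
  qed
  let ?P = "char_poly_matrix A"
  let ?x = "map_vec (\<lambda>c. [:c:]) x"
  have P: "?P \<in> carrier_mat n n" using A by simp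
  \<comment> \<open>Over the polynomials, \<open>x\<close> is an eigenvector of
    \<open>X I - A\<close> with eigenvalue \<open>X - l\<close>.\<close>
  have Px: "?P *\<^sub>v ?x = [:- l, 1:] \<cdot>\<^sub>v ?x"
  proof (rule eq_vecI)
    fix i assume i: "i < dim_vec ([:- l, 1:] \<cdot>\<^sub>v ?x)"
    then have i: "i < n" using xc by simp
    have "(?P *\<^sub>v ?x) $ i = (\<Sum>j<n. ?P $$ (i,j) * [:x $ j:])"
      using xc i carrier_matD[OF P] by (simp add: scalar_prod_def lessThan_atLeast0)
    also have "\<dots> = (\<Sum>j<n. (if j = i then [:0, 1:] * [:x $ j:] else 0) - [:A $$ (i,j) * x $ j:])"
      by (intro sum.cong refl) (use A i in \<open>auto simp: char_poly_matrix_def\<close>)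
    also have "\<dots> = [:0, 1:] * [:x $ i:] - (\<Sum>j<n. [:A $$ (i,j) * x $ j:])"
      using i by (simp add: sum_subtractf)
    also have "(\<Sum>j<n. [:A $$ (i,j) * x $ j:]) = [:l * x $ i:]"
      using Axi[OF i] by (metis (no_types, lifting) sum.cong sum_to_poly)
    finally show "(?P *\<^sub>v ?x) $ i = ([:- l, 1:] \<cdot>\<^sub>v ?x) $ i"
      using i xc by simp
  qed (use P xc in auto)
  define R where "R = replace_col ?P ?x k"
  have R: "R \<in> carrier_mat n n" using P by (auto simp: R_def replace_col_def)
  have "replace_col ?P ([:- l, 1:] \<cdot>\<^sub>v ?x) k = multcol k [:- l, 1:] R"
    using P xc k by (intro eq_matI) (auto simp: R_def replace_col_def)
  then have "[:- l, 1:] * det R = det (replace_col ?P (?P *\<^sub>v ?x) k)"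
    using det_multcol[OF k(1) R] by (simp add: Px)
  also have "\<dots> = [:x $ k:] * char_poly A"
    using xc k(1) by (subst cramer_lemma_mat[OF P _ k(1)]) (simp_all add: char_poly_def)
  finally have eq: "[:- l, 1:] * det R = [:x $ k:] * char_poly A" .
  \<comment> \<open>The double root supplies two factors \<open>X - l\<close>. Cramer's identity
    uses up only one of them, so the other divides \<open>det R\<close>.\<close>
  have "[:- l, 1:] ^ 2 dvd char_poly A" using ord by (rule order_divides[THEN iffD2, OF disjI2])
  then have "[:- l, 1:] ^ 2 dvd [:- l, 1:] * det R" unfolding eq by (rule dvd_mult)
  then have "[:- l, 1:] dvd det R"
    unfolding power2_eq_square by (subst (asm) dvd_mult_cancel_left) simp
  then have dR: "poly (det R) l = 0" by (simp add: poly_eq_0_iff_dvd)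
  define M where "M = map_mat (\<lambda>p. poly p l) R"
  have M: "M \<in> carrier_mat n n" using R by (simp add: M_def)
  have "poly (det R) l = det M"
    by (rule poly_det_cong[OF M R]) (use R in \<open>auto simp: M_def\<close>)
  then have "det M = 0" using dR by simp
  then obtain y where y: "y \<in> carrier_vec n" "y \<noteq> 0\<^sub>v n" "M *\<^sub>v y = 0\<^sub>v n"
    using det_0_iff_vec_prod_zero[OF M] by blast
  have Mij: "M $$ (i,j) = (if j = k then x $ i else (if i = j then l else 0) - A $$ (i,j))"
    if "i < n" "j < n" for i j
    using that A P xc by (auto simp: M_def R_def replace_col_def char_poly_matrix_def)
  \<comment> \<open>Column \<open>k\<close> of \<open>M\<close> is \<open>x\<close> and its other
    columns are those of \<open>l I - A\<close>. Hence \<open>M y = 0\<close> says that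
    \<open>y $ k\<close> times \<open>x\<close>, plus \<open>l I - A\<close> applied to
    \<open>z\<close>, is zero.\<close>
  define z where "z = (\<lambda>j. if j = k then 0 else y $ j)"
  have row: "y $ k * x $ i + l * z i - (\<Sum>j<n. A $$ (i,j) * z j) = 0" if i: "i < n" for i
  proof -
    have "0 = (M *\<^sub>v y) $ i" using i by (simp only: y(3) index_zero_vec)
    also have "\<dots> = (\<Sum>j<n. M $$ (i,j) * y $ j)"
      using M y(1) i by (simp add: scalar_prod_def lessThan_atLeast0)
    also have "\<dots> = (\<Sum>j<n. (if j = k then y $ k * x $ i else 0) + (if j = i then l * z i else 0)
        - A $$ (i,j) * z j)"
      by (intro sum.cong refl) (use i in \<open>auto simp: Mij z_def algebra_simps\<close>)
    also have "\<dots> = y $ k * x $ i + l * z i - (\<Sum>j<n. A $$ (i,j) * z j)"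
      using i k by (simp add: sum_subtractf sum.distrib)
    finally show ?thesis by simp
  qed
  have "(\<Sum>i<n. x $ i * (\<Sum>j<n. A $$ (i,j) * z j)) = (\<Sum>i<n. \<Sum>j<n. x $ i * A $$ (i,j) * z j)"
    by (simp add: sum_distrib_left mult_ac)
  also have "\<dots> = (\<Sum>j<n. \<Sum>i<n. x $ i * A $$ (i,j) * z j)" by (rule sum.swap)
  also have "\<dots> = (\<Sum>j<n. z j * (\<Sum>i<n. A $$ (j,i) * x $ i))"
    by (simp add: sum_distrib_left mult_ac sym)
  also have "\<dots> = (\<Sum>j<n. z j * (l * x $ j))" by (simp add: Axi)
  finally have s: "(\<Sum>i<n. x $ i * (\<Sum>j<n. A $$ (i,j) * z j)) = (\<Sum>j<n. z j * (l * x $ j))" .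
  \<comment> \<open>Pairing with \<open>x\<close> removes the part in \<open>l I - A\<close>, since
    \<open>A\<close> is symmetric and \<open>x\<close> is an eigenvector. What remains is
    \<open>y $ k\<close> times the squared norm of \<open>x\<close>.\<close>
  have "0 = (\<Sum>i<n. x $ i * (y $ k * x $ i + l * z i - (\<Sum>j<n. A $$ (i,j) * z j)))"
    by (simp add: row)
  also have "\<dots> = (\<Sum>i<n. y $ k * (x $ i * x $ i)) + (\<Sum>j<n. z j * (l * x $ j))
      - (\<Sum>i<n. x $ i * (\<Sum>j<n. A $$ (i,j) * z j))"
    by (simp add: right_diff_distrib distrib_left sum.distrib sum_subtractf mult_ac)
  also have "\<dots> = y $ k * (\<Sum>i<n. x $ i * x $ i)" unfolding s by (simp add: sum_distrib_left)
  finally have "y $ k * (\<Sum>i<n. x $ i * x $ i) = 0" by simp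
  moreover have "(\<Sum>i<n. x $ i * x $ i) > 0"
    using k by (intro sum_sq_pos[of _ k]) auto
  ultimately have yk: "y $ k = 0" by simp
  have zy: "z j = y $ j" for j using yk by (simp add: z_def)
  have "A *\<^sub>v y = l \<cdot>\<^sub>v y"
  proof (rule eq_vecI)
    fix i assume "i < dim_vec (l \<cdot>\<^sub>v y)"
    then have i: "i < n" using y by simp
    then show "(A *\<^sub>v y) $ i = (l \<cdot>\<^sub>v y) $ i"
      using row[OF i] A y by (simp add: zy yk scalar_prod_def lessThan_atLeast0)
  qed (use A y in auto)
  with y A yk show ?thesis by (auto simp: eigenvector_def)
qed


section \<open>Large eigenvalues of induced subgraphs\<close>

lemma eigenfunction_uminus:
  "eigenfunction S a l f \<Longrightarrow> eigenfunction S a l (\<lambda>u. - f u)"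
  by (simp add: eigenfunction_def sum_negf)

text \<open>This moves a Rayleigh quotient from the whole graph to an induced subgraph that carries
  the test function.\<close>

lemma bilin_cong_support:
  assumes "finite V" "S \<subseteq> V" "\<And>u. u \<in> V - S \<Longrightarrow> h u = 0"
  shows "bilin S a h h = bilin V a h h" "(\<Sum>u\<in>S. h u * h u) = (\<Sum>u\<in>V. h u * h u)"
proof -
  show "(\<Sum>u\<in>S. h u * h u) = (\<Sum>u\<in>V. h u * h u)"
    using assms by (intro sum.mono_neutral_left) auto
  have "(\<Sum>w\<in>S. a u w * h w) = (\<Sum>w\<in>V. a u w * h w)" for u
    using assms by (intro sum.mono_neutral_left) auto
  then show "bilin S a h h = bilin V a h h"
    unfolding bilin_def using assms by (intro sum.mono_neutral_cong_left) auto
qed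

text \<open>On the span of \<open>f\<close> and \<open>g\<close> the form is diagonal by
  orthogonality, so every Rayleigh quotient there is a weighted mean of \<open>l\<close> and
  \<open>m\<close> and exceeds \<open>c\<close>. A nonzero element of the span vanishing at
  \<open>v\<close> then serves as test function after the deletion.\<close>

lemma orthogonal_eigenfunctions_delete_vertex:
  assumes V: "finite V" and sym: "\<And>u w. a u w = a w u"
    and f: "eigenfunction V a l f" and g: "eigenfunction V a m g"
    and orth: "(\<Sum>u\<in>V. f u * g u) = 0" and lm: "l > c" "m > c"
  shows "\<exists>k > c. \<exists>h. eigenfunction (V - {v}) a k h"
proof -
  \<comment> \<open>The case \<open>f v = 0\<close> is separate because \<open>(g v, - f v)\<close>
    could then be the zero pair.\<close>
  obtain p q where pq: "p \<noteq> 0 \<or> q \<noteq> 0" "p * f v + q * g v = 0"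
  proof (cases "f v = 0")
    case True
    then show ?thesis using that[of 1 0] by simp
  next
    case False
    then show ?thesis using that[of "g v" "- f v"] by simp
  qed
  define h where "h = (\<lambda>u. p * f u + q * g u)"
  have fg: "(\<Sum>u\<in>V. g u * f u) = 0" using orth by (simp add: mult.commute)
  define F G where "F = (\<Sum>u\<in>V. f u * f u)" and "G = (\<Sum>u\<in>V. g u * g u)"
  have pos: "F > 0" "G > 0"
    using eigenfunction_sq_pos[OF V f] eigenfunction_sq_pos[OF V g] by (simp_all add: F_def G_def)
  have q: "bilin V a h h = l * (p * p * F) + m * (q * q * G)"
    unfolding h_def bilin_add_left bilin_add_right bilin_scale_left bilin_scale_right
    by (simp add: eigenfunction_bilin[OF f] eigenfunction_bilin[OF g] orth fg F_def G_def)
  have "(\<Sum>u\<in>V. h u * h u)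
      = (\<Sum>u\<in>V. p * p * (f u * f u) + q * q * (g u * g u) + 2 * p * q * (f u * g u))"
    by (intro sum.cong refl) (simp add: h_def algebra_simps)
  also have "\<dots> = p * p * F + q * q * G"
    by (simp add: sum.distrib sum_distrib_left[symmetric] orth F_def G_def)
  finally have nrm: "(\<Sum>u\<in>V. h u * h u) = p * p * F + q * q * G" .
  have "(l - c) * (p * p * F) + (m - c) * (q * q * G) > 0"
  proof -
    have "(l - c) * (p * p * F) \<ge> 0" "(m - c) * (q * q * G) \<ge> 0" using lm pos by simp_all
    moreover have "(l - c) * (p * p * F) > 0 \<or> (m - c) * (q * q * G) > 0"
      using pq(1) lm pos by (auto simp: zero_less_mult_iff linorder_neq_iff)
    ultimately show ?thesis by linarith
  qed
  then have "bilin V a h h > c * (\<Sum>u\<in>V. h u * h u)" by (simp add: q nrm algebra_simps)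
  moreover have "h u = 0" if "u \<in> V - (V - {v})" for u using that pq by (auto simp: h_def)
  ultimately have "bilin (V - {v}) a h h > c * (\<Sum>u\<in>V - {v}. h u * h u)"
    using bilin_cong_support[OF V, of "V - {v}" h] by simp
  then show ?thesis using V by (intro rayleigh_eigenfunction) (auto intro: sym)
qed

text \<open>The test function is the positive part \<open>h\<close> of \<open>f\<close>. Since
  \<open>f \<le> h\<close> and the weights are nonnegative, replacing \<open>f\<close> by
  \<open>h\<close> in the inner sum cannot decrease the form, so the quotient of \<open>h\<close> is
  at least \<open>l\<close>.\<close>

lemma positive_support_eigenvalue:
  assumes V: "finite V" and sym: "\<And>u w. a u w = a w u" and nonneg: "\<And>u w. a u w \<ge> 0"
    and f: "eigenfunction V a l f" and lc: "l > c"
    and u: "u \<in> V" "f u > 0" and S: "{u\<in>V. f u > 0} \<subseteq> S" "S \<subseteq> V"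
  shows "\<exists>k > c. \<exists>h. eigenfunction S a k h"
proof -
  define h where "h = (\<lambda>u. max 0 (f u))"
  have "l * (\<Sum>u\<in>V. h u * h u) = (\<Sum>u\<in>V. h u * (l * f u))"
    unfolding sum_distrib_left by (intro sum.cong refl) (simp add: h_def max_def)
  also have "\<dots> = (\<Sum>u\<in>V. h u * (\<Sum>w\<in>V. a u w * f w))"
    using f by (intro sum.cong refl) (simp add: eigenfunction_def)
  also have "\<dots> \<le> bilin V a h h"
    unfolding bilin_def
    by (intro sum_mono mult_left_mono) (auto simp: h_def nonneg)
  finally have "l * (\<Sum>u\<in>V. h u * h u) \<le> bilin V a h h" .
  moreover have "c * (\<Sum>u\<in>V. h u * h u) < l * (\<Sum>u\<in>V. h u * h u)"
    using lc sum_sq_pos[OF V u(1), of h] u(2) by (simp add: h_def)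
  moreover have "h w = 0" if "w \<in> V - S" for w using that S by (auto simp: h_def max_def)
  ultimately have "bilin S a h h > c * (\<Sum>u\<in>S. h u * h u)"
    using bilin_cong_support[OF V S(2), of h] by simp
  then show ?thesis using finite_subset[OF S(2) V] by (intro rayleigh_eigenfunction) (auto intro: sym)
qed

text \<open>If one of the eigenfunctions changes sign, its positive and negative supports will do; otherwise
  orthogonality makes the supports of the two eigenfunctions disjoint.\<close>

lemma orthogonal_eigenfunctions_disjoint_supports:
  assumes V: "finite V" and sym: "\<And>u w. a u w = a w u" and nonneg: "\<And>u w. a u w \<ge> 0"
    and f: "eigenfunction V a l f" and g: "eigenfunction V a m g"
    and orth: "(\<Sum>u\<in>V. f u * g u) = 0" and lm: "l > c" "m > c"
  shows "\<exists>P N. P \<subseteq> V \<and> N \<subseteq> V \<and> P \<inter> N = {}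
    \<and> (\<forall>S. S \<subseteq> V \<longrightarrow> P \<subseteq> S \<or> N \<subseteq> S \<longrightarrow> (\<exists>k > c. \<exists>h. eigenfunction S a k h))"
proof -
  define pos where "pos f = {u\<in>V. f u > 0}" for f :: "'a \<Rightarrow> real"
  have pos: "\<exists>k > c. \<exists>h. eigenfunction S a k h"
    if "eigenfunction V a k f" "k > c" "pos f \<noteq> {}" "pos f \<subseteq> S" "S \<subseteq> V" for k f S
    using positive_support_eigenvalue[OF V sym nonneg that(1,2)] that(3-) by (auto simp: pos_def)
  have ok: ?thesis
    if "eigenfunction V a k f" "k > c" "pos f \<noteq> {}" "eigenfunction V a k' f'" "k' > c" "pos f' \<noteq> {}"
      "pos f \<inter> pos f' = {}" for k k' f f'
    by (rule exI[of _ "pos f"], rule exI[of _ "pos f'"])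
      (use that pos[of k f] pos[of k' f'] in \<open>auto simp: pos_def\<close>)
  have sgn: ?thesis
    if "eigenfunction V a k f" "k > c" "pos f \<noteq> {}" "pos (\<lambda>u. - f u) \<noteq> {}" for k f
    by (rule ok[OF that(1-3) eigenfunction_uminus[OF that(1)] that(2,4)]) (auto simp: pos_def)
  \<comment> \<open>An eigenfunction that does not change sign becomes nonnegative after
    multiplication by 1 or -1.\<close>
  have nonneg_version: "\<exists>s\<in>{1,-1}. eigenfunction V a k (\<lambda>u. s * f u)
      \<and> (\<forall>u\<in>V. s * f u \<ge> 0) \<and> pos (\<lambda>u. s * f u) \<noteq> {}"
    if k: "eigenfunction V a k f" and one: "pos f = {} \<or> pos (\<lambda>u. - f u) = {}" for k f
  proof -
    obtain u where u: "u \<in> V" "f u \<noteq> 0" using k by (auto simp: eigenfunction_def)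
    show ?thesis
    proof (cases "pos f = {}")
      case True
      then have le: "f w \<le> 0" if "w \<in> V" for w using that by (auto simp: pos_def not_less)
      with u have "u \<in> pos (\<lambda>u. - f u)" by (auto simp: pos_def less_le)
      with le show ?thesis using eigenfunction_uminus[OF k] by auto
    next
      case False
      with one have "pos (\<lambda>u. - f u) = {}" by simp
      then have "f w \<ge> 0" if "w \<in> V" for w using that by (auto simp: pos_def not_less)
      with False show ?thesis using k by auto
    qed
  qed
  show ?thesis
  proof (cases "(pos f = {} \<or> pos (\<lambda>u. - f u) = {}) \<and> (pos g = {} \<or> pos (\<lambda>u. - g u) = {})")
    case False
    then show ?thesis using sgn[OF f lm(1)] sgn[OF g lm(2)] by blast
  next
    case True
    obtain s where s: "eigenfunction V a l (\<lambda>u. s * f u)" "\<forall>u\<in>V. s * f u \<ge> 0"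
      "pos (\<lambda>u. s * f u) \<noteq> {}" using nonneg_version[OF f] True by blast
    obtain t where t: "eigenfunction V a m (\<lambda>u. t * g u)" "\<forall>u\<in>V. t * g u \<ge> 0"
      "pos (\<lambda>u. t * g u) \<noteq> {}" using nonneg_version[OF g] True by blast
    have "(\<Sum>u\<in>V. (s * f u) * (t * g u)) = (\<Sum>u\<in>V. s * t * (f u * g u))"
      by (intro sum.cong refl) simp
    also have "\<dots> = 0" by (simp add: sum_distrib_left[symmetric] orth)
    \<comment> \<open>A vanishing sum of nonnegative terms has only zero terms, so no vertex lies in
      both supports.\<close>
    finally have "\<forall>u\<in>V. (s * f u) * (t * g u) = 0"
      using V s(2) t(2) by (subst (asm) sum_nonneg_eq_0_iff) auto
    then have "pos (\<lambda>u. s * f u) \<inter> pos (\<lambda>u. t * g u) = {}"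
      by (auto simp: pos_def)
    then show ?thesis using ok[OF s(1) lm(1) s(3) t(1) lm(2) t(3)] by blast
  qed
qed

section \<open>Translation between adjacency matrices and eigenfunctions\<close>

text \<open>The adjacency matrix indexed by vertices, free of the ordering on which
  \<open>adj_mat\<close> depends.\<close>

definition adj :: "('a \<Rightarrow> 'a \<Rightarrow> bool) \<Rightarrow> 'a \<Rightarrow> 'a \<Rightarrow> real" where
  "adj E u w = (if E u w then 1 else 0)"

lemma sum_sorted_list_of_set_nth:
  assumes "finite S"
  shows "(\<Sum>w\<in>S. h w) = (\<Sum>j<card S. h (sorted_list_of_set S ! j))"
proof -
  have "bij_betw ((!) (sorted_list_of_set S)) {..<card S} S"
    by (rule bij_betw_nth) (use assms in auto)
  then show ?thesis by (rule sum.reindex_bij_betw[symmetric])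
qed

lemma adj_mat_carrier: "adj_mat S E \<in> carrier_mat (card S) (card S)"
  by (simp add: adj_mat_def Let_def)

lemma adj_mat_index:
  assumes "i < card S" "j < card S"
  shows "adj_mat S E $$ (i, j) = adj E (sorted_list_of_set S ! i) (sorted_list_of_set S ! j)"
  using assms by (simp add: adj_mat_def Let_def adj_def)

lemma in_set_conv_sorted_nth:
  "finite S \<Longrightarrow> u \<in> S \<longleftrightarrow> (\<exists>i<card S. u = sorted_list_of_set S ! i)"
  by (metis in_set_conv_nth length_sorted_list_of_set set_sorted_list_of_set)

lemma eigenvector_adj_mat_iff:
  assumes S: "finite S"
  shows "eigenvector (adj_mat S E) (vec (card S) (\<lambda>i. f (sorted_list_of_set S ! i))) l
    \<longleftrightarrow> eigenfunction S (adj E) l f" (is "eigenvector ?A ?x l \<longleftrightarrow> _")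
proof -
  let ?n = "card S" and ?v = "\<lambda>i. sorted_list_of_set S ! i"
  note A = adj_mat_carrier[of S E]
  have "(?A *\<^sub>v ?x) $ i = (\<Sum>w\<in>S. adj E (?v i) w * f w)" if "i < ?n" for i
    unfolding sum_sorted_list_of_set_nth[OF S] using A that
    by (simp add: scalar_prod_def lessThan_atLeast0 adj_mat_index)
  then have "?A *\<^sub>v ?x = l \<cdot>\<^sub>v ?x
      \<longleftrightarrow> (\<forall>i<?n. (\<Sum>w\<in>S. adj E (?v i) w * f w) = l * f (?v i))"
    using A by (auto simp: vec_eq_iff)
  moreover have "?x \<noteq> 0\<^sub>v ?n \<longleftrightarrow> (\<exists>i<?n. f (?v i) \<noteq> 0)" by (auto simp: vec_eq_iff)
  ultimately show ?thesis
    using A in_set_conv_sorted_nth[OF S]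
    by (auto simp: eigenvector_def eigenfunction_def)
qed

text \<open>The sorted list has distinct entries, so indices can be recovered from vertices. Thus
  every eigenvector of \<open>adj_mat\<close> comes from an eigenfunction.\<close>

lemma vec_eq_vec_sorted_nth:
  assumes "finite S" "x \<in> carrier_vec (card S)"
  shows "\<exists>f. x = vec (card S) (\<lambda>i. f (sorted_list_of_set S ! i))"
proof -
  have inj: "inj_on ((!) (sorted_list_of_set S)) {..<card S}"
    by (rule inj_on_nth) (use assms(1) in auto)
  show ?thesis
    by (rule exI[of _ "\<lambda>u. x $ the_inv_into {..<card S} ((!) (sorted_list_of_set S)) u"], rule eq_vecI)
      (use assms(2) in \<open>auto simp: the_inv_into_f_f[OF inj]\<close>)
qed

lemma eigenvectorE:
  assumes "finite S" "eigenvector (adj_mat S E) x l"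
  obtains f where "x = vec (card S) (\<lambda>i. f (sorted_list_of_set S ! i))" "eigenfunction S (adj E) l f"
proof -
  have "x \<in> carrier_vec (card S)" using assms(2) adj_mat_carrier[of S E] by (auto simp: eigenvector_def)
  then show ?thesis using vec_eq_vec_sorted_nth[OF assms(1)] eigenvector_adj_mat_iff[OF assms(1)] assms(2) that
    by metis
qed

lemma graph_eigenvalue_iff:
  assumes "finite S"
  shows "graph_eigenvalue S E l \<longleftrightarrow> (\<exists>f. eigenfunction S (adj E) l f)"
  unfolding graph_eigenvalue_def eigenvalue_def
  using eigenvectorE[OF assms] eigenvector_adj_mat_iff[OF assms] by metis

lemma char_poly_adj_mat_nonzero: "char_poly (adj_mat S E) \<noteq> 0"
  using degree_monic_char_poly[OF adj_mat_carrier[of S E]] by auto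

lemma eig_mult_pos_iff: "eig_mult S E l > 0 \<longleftrightarrow> graph_eigenvalue S E l"
  unfolding eig_mult_def graph_eigenvalue_def eigenvalue_root_char_poly[OF adj_mat_carrier]
  using order_root[of "char_poly (adj_mat S E)" l] char_poly_adj_mat_nonzero[of S E] by auto

text \<open>A multiple root yields a second eigenfunction that vanishes at a vertex where the first
  does not. The two are therefore independent, and a Gram-Schmidt step makes them
  orthogonal.\<close>

lemma eig_mult_ge_2_orthogonal_eigenfunctions:
  assumes S: "finite S" and sym: "\<And>u w. E u w \<Longrightarrow> E w u" and mult: "eig_mult S E l \<ge> 2"
  shows "\<exists>f g. eigenfunction S (adj E) l f \<and> eigenfunction S (adj E) l g \<and> (\<Sum>u\<in>S. f u * g u) = 0"
proof -
  let ?v = "\<lambda>i. sorted_list_of_set S ! i"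
  have "graph_eigenvalue S E l" using mult by (simp add: eig_mult_pos_iff[symmetric])
  then obtain f where f: "eigenfunction S (adj E) l f" using graph_eigenvalue_iff[OF S] by blast
  then obtain k where k: "k < card S" "f (?v k) \<noteq> 0"
    using in_set_conv_sorted_nth[OF S] by (auto simp: eigenfunction_def)
  have "adj E u w = adj E w u" for u w using sym by (auto simp: adj_def)
  then have "\<exists>y. eigenvector (adj_mat S E) y l \<and> y $ k = 0"
    using k f mult unfolding eig_mult_def
    by (intro symmetric_multiple_root_eigenvector[OF adj_mat_carrier, where x = "vec (card S) (\<lambda>i. f (?v i))"])
      (auto simp: adj_mat_index eigenvector_adj_mat_iff[OF S])
  then obtain g where g: "eigenfunction S (adj E) l g" and gk: "g (?v k) = 0"
    using eigenvectorE[OF S] k(1) by (metis index_vec)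
  define c where "c = (\<Sum>u\<in>S. f u * g u) / (\<Sum>u\<in>S. f u * f u)"
  define h where "h = (\<lambda>u. g u - c * f u)"
  have "(\<Sum>u\<in>S. f u * h u) = (\<Sum>u\<in>S. f u * g u) - c * (\<Sum>u\<in>S. f u * f u)"
    by (simp add: h_def right_diff_distrib sum_subtractf sum_distrib_left mult_ac)
  also have "\<dots> = 0" using eigenfunction_sq_pos[OF S f] by (simp add: c_def)
  finally have orth: "(\<Sum>u\<in>S. f u * h u) = 0" .
  \<comment> \<open>For \<open>c = 0\<close> the function \<open>h\<close> is \<open>g\<close>;
    otherwise its value at the \<open>k\<close>-th vertex is \<open>- c\<close> times the nonzero
    value of \<open>f\<close> there.\<close>
  have "\<exists>u\<in>S. h u \<noteq> 0"
  proof (cases "c = 0")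
    case True
    then show ?thesis using g by (simp add: h_def eigenfunction_def)
  next
    case False
    then have "h (?v k) \<noteq> 0" using gk k by (simp add: h_def)
    then show ?thesis using k in_set_conv_sorted_nth[OF S] by blast
  qed
  moreover have "(\<Sum>w\<in>S. adj E u w * h w) = l * h u" if "u \<in> S" for u
  proof -
    have "(\<Sum>w\<in>S. adj E u w * h w) = (\<Sum>w\<in>S. adj E u w * g w) - c * (\<Sum>w\<in>S. adj E u w * f w)"
      by (simp add: h_def right_diff_distrib sum_subtractf sum_distrib_left mult_ac)
    then show ?thesis using f g that by (simp add: eigenfunction_def h_def algebra_simps)
  qed
  ultimately have "eigenfunction S (adj E) l h" by (simp add: eigenfunction_def)
  with f orth show ?thesis by blast
qed

section \<open>Spectral symmetry of bipartite graphs\<close>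

text \<open>Changing signs on one side of the bipartition negates every edge term. The property
  \<open>s u * s u = 1\<close> is recorded so that flipping two functions at once preserves their
  inner product.\<close>

lemma bipartite_sign:
  assumes "bipartite V E"
  obtains s :: "'a \<Rightarrow> real" where "\<And>u. s u * s u = 1"
    "\<And>l f. eigenfunction V (adj E) l f \<Longrightarrow> eigenfunction V (adj E) (- l) (\<lambda>u. s u * f u)"
proof -
  from assms obtain A where A: "\<forall>u\<in>V. \<forall>w\<in>V. E u w \<longrightarrow> (u \<in> A \<longleftrightarrow> w \<notin> A)"
    unfolding bipartite_def by (elim exE conjE) (rule that)
  define s :: "'a \<Rightarrow> real" where "s = (\<lambda>u. if u \<in> A then 1 else - 1)"
  have flip: "eigenfunction V (adj E) (- l) (\<lambda>u. s u * f u)" if f: "eigenfunction V (adj E) l f" for l f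
  proof -
    have "(\<Sum>w\<in>V. adj E u w * (s w * f w)) = - l * (s u * f u)" if u: "u \<in> V" for u
    proof -
      have "adj E u w * (s w * f w) = - s u * (adj E u w * f w)" if "w \<in> V" for w
      proof (cases "E u w")
        case True
        with A[rule_format, OF u that] have "s w = - s u" by (cases "u \<in> A") (simp_all add: s_def)
        then show ?thesis by simp
      qed (simp add: adj_def)
      then have "(\<Sum>w\<in>V. adj E u w * (s w * f w)) = (\<Sum>w\<in>V. - s u * (adj E u w * f w))"
        by (rule sum.cong[OF refl])
      also have "\<dots> = - s u * (\<Sum>w\<in>V. adj E u w * f w)" by (rule sum_distrib_left[symmetric])
      also have "\<dots> = - s u * (l * f u)" using f u by (simp add: eigenfunction_def)
      finally show ?thesis by simp
    qed
    moreover have "\<exists>u\<in>V. s u * f u \<noteq> 0" using f by (auto simp: eigenfunction_def s_def)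
    ultimately show ?thesis by (simp add: eigenfunction_def)
  qed
  have "s u * s u = 1" for u by (simp add: s_def)
  from that[OF this flip] show ?thesis .
qed

text \<open>Either two distinct eigenvalues exceed 2, and their eigenfunctions are orthogonal, or
  there is just one, \<open>l\<close>. In the second case symmetry leaves only \<open>- l\<close>
  below -2, so failing to be Salem forces multiplicity at least 2 at \<open>l\<close> or
  \<open>- l\<close>.\<close>

lemma not_salem_orthogonal_eigenfunctions:
  assumes G: "simple_graph V E" and bip: "bipartite V E"
    and nc: "\<not> cyclotomic V E" and ns: "\<not> salem_graph V E"
  shows "\<exists>l>2. \<exists>m>2. \<exists>f g. eigenfunction V (adj E) l f \<and> eigenfunction V (adj E) m g
    \<and> (\<Sum>u\<in>V. f u * g u) = 0"
proof -
  have V: "finite V" and E: "\<And>u w. E u w \<Longrightarrow> E w u" using G by (auto simp: simple_graph_def)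
  have sym: "adj E u w = adj E w u" for u w using E by (auto simp: adj_def)
  note ge = graph_eigenvalue_iff[OF V]
  obtain s where s: "\<And>u. s u * s u = 1"
    and flip: "\<And>l f. eigenfunction V (adj E) l f \<Longrightarrow> eigenfunction V (adj E) (- l) (\<lambda>u. s u * f u)"
    by (rule bipartite_sign[OF bip]) (rule that)
  have neg: "graph_eigenvalue V E (- x)" if "graph_eigenvalue V E x" for x
    using that flip ge by blast
  obtain l where l: "l > 2" "graph_eigenvalue V E l"
    using nc neg unfolding cyclotomic_def by (metis less_minus_iff linorder_not_less)
  show ?thesis
  proof (cases "\<exists>m>2. m \<noteq> l \<and> graph_eigenvalue V E m")
    case True
    then obtain m f g where m: "m > 2" "l \<noteq> m"
      and fg: "eigenfunction V (adj E) l f" "eigenfunction V (adj E) m g"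
      using l ge by blast
    have "(\<Sum>u\<in>V. f u * g u) = 0" by (rule eigenfunctions_orthogonal[OF sym fg m(2)])
    with l(1) m(1) fg show ?thesis by auto
  next
    case False
    then have up: "x = l" if "graph_eigenvalue V E x" "x > 2" for x using that by blast
    have low: "x = - l" if "graph_eigenvalue V E x" "x < - 2" for x
      using up[OF neg[OF that(1)]] that(2) by simp
    have "\<not> (eig_mult V E l = 1 \<and> eig_mult V E (- l) = 1)"
      using ns bip l(1) up low unfolding salem_graph_def by blast
    moreover have "eig_mult V E l > 0" "eig_mult V E (- l) > 0"
      using l(2) neg by (auto simp: eig_mult_pos_iff)
    ultimately consider "eig_mult V E l \<ge> 2" | "eig_mult V E (- l) \<ge> 2" by linarith
    then show ?thesis
    proof cases
      case 1
      then show ?thesis using eig_mult_ge_2_orthogonal_eigenfunctions[of V E, OF V E] l(1) by blast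
    next
      \<comment> \<open>The orthogonal pair for \<open>- l\<close> is carried to one for
        \<open>l\<close> by the sign change \<open>s\<close>.\<close>
      case 2
      then obtain f g where fg: "eigenfunction V (adj E) (- l) f" "eigenfunction V (adj E) (- l) g"
        "(\<Sum>u\<in>V. f u * g u) = 0"
        using eig_mult_ge_2_orthogonal_eigenfunctions[of V E, OF V E] by blast
      have "(s u * f u) * (s u * g u) = f u * g u" for u
        using s[of u] by (metis (no_types, opaque_lifting) mult.assoc mult.left_commute mult_1)
      then have "(\<Sum>u\<in>V. (s u * f u) * (s u * g u)) = 0" using fg(3) by (simp only:)
      then show ?thesis using flip[OF fg(1)] flip[OF fg(2)] l(1) by auto
    qed
  qed
qed

section \<open>Minimal induced subgraphs and the two Salem criteria\<close>

text \<open>The spectrum is finite, so \<open>Max\<close> bounds it; an eigenvalue forces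
  \<open>S\<close> to be nonempty, which rules out the default index 0.\<close>

lemma graph_index_gt_2:
  assumes S: "finite S" and x: "graph_eigenvalue S E x" "x > 2"
  shows "graph_index S E > 2"
proof -
  have "finite {x. graph_eigenvalue S E x}"
    unfolding graph_eigenvalue_def eigenvalue_root_char_poly[OF adj_mat_carrier]
    by (rule poly_roots_finite[OF char_poly_adj_mat_nonzero])
  then have "x \<le> Max {x. graph_eigenvalue S E x}" using x by (intro Max_ge) auto
  moreover have "S \<noteq> {}" using x(1) graph_eigenvalue_iff[OF S] by (auto simp: eigenfunction_def)
  ultimately show ?thesis using x(2) by (simp add: graph_index_def)
qed

text \<open>An inclusion-minimal subset of \<open>P\<close> with index above 2 works, as deleting a
  vertex gives a proper subset of it.\<close>

lemma minimal_induced_exists: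
  assumes "finite P" "P \<subseteq> V" "graph_index P E > 2"
  obtains M where "M \<subseteq> P" "minimal_induced V E M"
proof -
  let ?H = "{M. M \<subseteq> P \<and> graph_index M E > 2}"
  have "finite ?H" using assms(1) by simp
  moreover have "?H \<noteq> {}" using assms(3) by auto
  ultimately obtain M where M: "M \<in> ?H" "\<And>N. N \<in> ?H \<Longrightarrow> N \<subseteq> M \<Longrightarrow> M = N"
    using finite_has_minimal[of ?H] by auto
  have "graph_index (M - {v}) E \<le> 2" if "v \<in> M" for v
  proof (rule ccontr)
    assume "\<not> ?thesis"
    then have "M = M - {v}" using M(1) by (intro M(2)) auto
    with that show False by auto
  qed
  with M(1) assms(2) have "minimal_induced V E M" by (auto simp: minimal_induced_def)
  with M(1) that show ?thesis by auto
qed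

theorem theorem8:
  fixes V :: "'a::linorder set" and E :: "'a \<Rightarrow> 'a \<Rightarrow> bool"
  assumes "simple_graph V E"
  shows "(bipartite V E \<and> \<not> cyclotomic V E \<and> (\<exists>v\<in>V. cyclotomic (V - {v}) E)
            \<longrightarrow> salem_graph V E)
       \<and> (bipartite V E \<and> \<not> cyclotomic V E
            \<and> (\<forall>M. minimal_induced V E M \<longrightarrow> cyclotomic (V - M) E)
            \<longrightarrow> salem_graph V E)"
proof (intro conjI impI; elim conjE; rule ccontr)
  have V: "finite V" and sym: "\<And>u w. adj E u w = adj E w u"
    using assms by (auto simp: simple_graph_def adj_def)
  have not_cyc: "\<not> cyclotomic S E" if "S \<subseteq> V" "\<exists>k>2. \<exists>h. eigenfunction S (adj E) k h" for S
    using that graph_eigenvalue_iff[OF finite_subset[OF that(1) V], of E]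
    by (auto simp: cyclotomic_def not_le)
  {
    assume h: "bipartite V E" "\<not> cyclotomic V E" "\<exists>v\<in>V. cyclotomic (V - {v}) E"
      "\<not> salem_graph V E"
    obtain l m f g where fg: "l > 2" "m > 2" "eigenfunction V (adj E) l f"
      "eigenfunction V (adj E) m g" "(\<Sum>u\<in>V. f u * g u) = 0"
      using not_salem_orthogonal_eigenfunctions[OF assms h(1,2,4)] by blast
    have "\<not> cyclotomic (V - {v}) E" for v
      using orthogonal_eigenfunctions_delete_vertex[OF V sym fg(3-5) fg(1,2)] by (intro not_cyc) auto
    with h(3) show False by blast
  next
    assume h: "bipartite V E" "\<not> cyclotomic V E"
      "\<forall>M. minimal_induced V E M \<longrightarrow> cyclotomic (V - M) E" "\<not> salem_graph V E"
    obtain l m f g where fg: "l > 2" "m > 2" "eigenfunction V (adj E) l f"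
      "eigenfunction V (adj E) m g" "(\<Sum>u\<in>V. f u * g u) = 0"
      using not_salem_orthogonal_eigenfunctions[OF assms h(1,2,4)] by blast
    have nonneg: "adj E u w \<ge> 0" for u w by (simp add: adj_def)
    obtain P N where PN: "P \<subseteq> V" "N \<subseteq> V" "P \<inter> N = {}"
      "\<forall>S. S \<subseteq> V \<longrightarrow> P \<subseteq> S \<or> N \<subseteq> S \<longrightarrow> (\<exists>k>2. \<exists>h. eigenfunction S (adj E) k h)"
      using orthogonal_eigenfunctions_disjoint_supports[OF V sym nonneg fg(3-5) fg(1,2)]
      by (elim exE conjE) (rule that)
    have P: "finite P" using PN(1) V by (rule finite_subset)
    have "graph_index P E > 2"
      using PN(4)[rule_format, of P] PN(1) graph_index_gt_2[OF P] graph_eigenvalue_iff[OF P, of E] by blast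
    then obtain M where M: "M \<subseteq> P" "minimal_induced V E M"
      using minimal_induced_exists[OF P PN(1)] by blast
    \<comment> \<open>Since \<open>M\<close> lies in \<open>P\<close>, which is disjoint from
      \<open>N\<close>, the complement of \<open>M\<close> contains \<open>N\<close>.\<close>
    have "\<not> cyclotomic (V - M) E"
      using M(1) PN by (intro not_cyc PN(4)[rule_format]) auto
    with h(3) M(2) show False by blast
  }
qed

end
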